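(* The logic $\mathbf{QML}$ is decidable: there is an algorithm which, given any formula $\alpha$ of $\mathbf{QML}$, determines in finitely many steps whether the sequent $\vdash \alpha$ (empty left-hand side) is derivable in the sequent calculus of $\mathbf{QML}$.
   Context: Formulas of $\mathbf{QML}$ are built from a countable set of atomic formulas $p,q,\dots$ using $\wedge$, $\neg$ and the unary modal operator $\Box$. A sequent is an expression $\Gamma\vdash\Delta$ with $\Gamma,\Delta$ finite (possibly empty) sets of formulas; $\alpha,\Gamma$ denotes $\{\alpha\}\cup\Gamma$, $\Gamma,\Delta$ denotes $\Gamma\cup\Delta$, $\neg\Gamma=\{\neg\gamma:\gamma\in\Gamma\}$, $\Box\Gamma=\{\Box\gamma:\gamma\in\Gamma\}$. The sequent calculus of $\mathbf{QML}$ has axioms (AX) $\alpha\vdash\alpha$ and (MEM) $\Gamma\vdash\Box\alpha,\neg\Box\alpha$, and rules (each written "upper sequent(s) / lower sequent"): (WKN) from $\Gamma\vdash\Delta$ infer $\Pi,\Gamma\vdash\Delta,\Sigma$; (CUT) from $\Gamma_1\vdash\Delta_1,\alpha$ and $\alpha,\Gamma_2\vdash\Delta_2$ infer $\Gamma_1,\Gamma_2\vdash\Delta_1,\Delta_2$; ($\wedge$l$_1$) from $\alpha,\Gamma\vdash\Delta$ infer $\alpha\wedge\beta,\Gamma\vdash\Delta$; ($\wedge$l$_2$) from $\beta,\Gamma\vdash\Delta$ infer $\alpha\wedge\beta,\Gamma\vdash\Delta$; ($\wedge$r) from $\Gamma\vdash\Delta,\alpha$ and $\Gamma\vdash\Delta,\beta$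 infer $\Gamma\vdash\Delta,\alpha\wedge\beta$; ($\neg$l) from $\Gamma\vdash\Delta,\alpha$ infer $\neg\alpha,\Gamma\vdash\Delta$; ($\neg$r) from $\alpha\vdash\Delta$ infer $\neg\Delta\vdash\neg\alpha$; ($\neg\neg$l) from $\alpha,\Gamma\vdash\Delta$ infer $\neg\neg\alpha,\Gamma\vdash\Delta$; ($\neg\neg$r) from $\Gamma\vdash\Delta,\alpha$ infer $\Gamma\vdash\Delta,\neg\neg\alpha$; (K) from $\Gamma\vdash\alpha$ infer $\Box\Gamma\vdash\Box\alpha$. A derivation is a finite sequence of sequents each of which is an axiom or the lower sequent of a rule whose upper sequents occur earlier; a sequent is derivable if it is the last element of some derivation. *)

theory Defs
  imports Main "HOL-Library.FSet" "HOL-Library.Nat_Bijection"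
begin

datatype fm =
    Atom nat
  | And fm fm
  | Neg fm
  | Box fm

datatype sequent = Sequent "fm fset" "fm fset"  (infix "\<turnstile>" 50)

text \<open>Comma notation in sequents is union of sets, so in \<open>finsert \<alpha> \<Delta>\<close> the formula \<open>\<alpha>\<close> may
  already occur in \<open>\<Delta>\<close>. \<open>inference ps s\<close> holds if \<open>s\<close> is the lower sequent of an instance of a
  rule with list of upper sequents \<open>ps\<close>; axioms have no upper sequents.\<close>

inductive inference :: "sequent list \<Rightarrow> sequent \<Rightarrow> bool" where
  AX: "inference [] ({|\<alpha>|} \<turnstile> {|\<alpha>|})"
| MEM: "inference [] (\<Gamma> \<turnstile> {|Box \<alpha>, Neg (Box \<alpha>)|})"
| WKN: "inference [\<Gamma> \<turnstile> \<Delta>] (\<Pi> |\<union>| \<Gamma> \<turnstile> \<Delta> |\<union>| \<Sigma>)"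
| CUT: "inference [\<Gamma>\<^sub>1 \<turnstile> finsert \<alpha> \<Delta>\<^sub>1, finsert \<alpha> \<Gamma>\<^sub>2 \<turnstile> \<Delta>\<^sub>2] (\<Gamma>\<^sub>1 |\<union>| \<Gamma>\<^sub>2 \<turnstile> \<Delta>\<^sub>1 |\<union>| \<Delta>\<^sub>2)"
| AndL1: "inference [finsert \<alpha> \<Gamma> \<turnstile> \<Delta>] (finsert (And \<alpha> \<beta>) \<Gamma> \<turnstile> \<Delta>)"
| AndL2: "inference [finsert \<beta> \<Gamma> \<turnstile> \<Delta>] (finsert (And \<alpha> \<beta>) \<Gamma> \<turnstile> \<Delta>)"
| AndR: "inference [\<Gamma> \<turnstile> finsert \<alpha> \<Delta>, \<Gamma> \<turnstile> finsert \<beta> \<Delta>] (\<Gamma> \<turnstile> finsert (And \<alpha> \<beta>) \<Delta>)"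
| NegL: "inference [\<Gamma> \<turnstile> finsert \<alpha> \<Delta>] (finsert (Neg \<alpha>) \<Gamma> \<turnstile> \<Delta>)"
| NegR: "inference [{|\<alpha>|} \<turnstile> \<Delta>] (Neg |`| \<Delta> \<turnstile> {|Neg \<alpha>|})"
| NegNegL: "inference [finsert \<alpha> \<Gamma> \<turnstile> \<Delta>] (finsert (Neg (Neg \<alpha>)) \<Gamma> \<turnstile> \<Delta>)"
| NegNegR: "inference [\<Gamma> \<turnstile> finsert \<alpha> \<Delta>] (\<Gamma> \<turnstile> finsert (Neg (Neg \<alpha>)) \<Delta>)"
| K: "inference [\<Gamma> \<turnstile> {|\<alpha>|}] (Box |`| \<Gamma> \<turnstile> {|Box \<alpha>|})"

definition derivation :: "sequent list \<Rightarrow> bool" where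
  "derivation ds \<longleftrightarrow>
    (\<forall>i < length ds. \<exists>ps. set ps \<subseteq> set (take i ds) \<and> inference ps (ds ! i))"

definition derivable :: "sequent \<Rightarrow> bool" where
  "derivable s \<longleftrightarrow> (\<exists>ds. derivation ds \<and> ds \<noteq> [] \<and> last ds = s)"

text \<open>The model of computation: descriptions of partial recursive functions on the natural numbers.
  \<open>eval f xs y\<close> says that \<open>f\<close> terminates on the arguments \<open>xs\<close> with value \<open>y\<close>. Descriptions carry no
  arities; one applied to an unsuitable argument list has no value.\<close>

datatype recfn =
    Zero
  | Succ
  | Proj nat
  | Comp recfn "recfn list"
  | PrimRec recfn recfn
  | Mu recfn

inductive eval :: "recfn \<Rightarrow> nat list \<Rightarrow> nat \<Rightarrow> bool" where
  Zero: "eval Zero xs 0"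
| Succ: "eval Succ [x] (Suc x)"
| Proj: "i < length xs \<Longrightarrow> eval (Proj i) xs (xs ! i)"
| Comp: "list_all2 (\<lambda>g y. eval g xs y) gs ys \<Longrightarrow> eval f ys z \<Longrightarrow> eval (Comp f gs) xs z"
| PrimRec_0: "eval f xs y \<Longrightarrow> eval (PrimRec f g) (0 # xs) y"
| PrimRec_Suc: "eval (PrimRec f g) (n # xs) y \<Longrightarrow> eval g (n # y # xs) z \<Longrightarrow>
    eval (PrimRec f g) (Suc n # xs) z"
| Mu: "eval f (n # xs) 0 \<Longrightarrow> (\<And>m. m < n \<Longrightarrow> \<exists>y. eval f (m # xs) (Suc y)) \<Longrightarrow> eval (Mu f) xs n"

inductive_cases eval_elims:
  "eval Zero xs y" "eval Succ xs y" "eval (Proj i) xs y" "eval (Comp f gs) xs y"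
  "eval (PrimRec f g) (0 # xs) y" "eval (PrimRec f g) (Suc n # xs) y" "eval (Mu f) xs y"

lemma eval_deterministic: "eval f xs y \<Longrightarrow> eval f xs z \<Longrightarrow> y = z"
proof (induction arbitrary: z rule: eval.induct)
  case (Comp xs gs ys f w)
  from Comp.prems obtain ys' where
    "list_all2 (\<lambda>g y. eval g xs y) gs ys'" and z: "eval f ys' z"
    by (rule eval_elims)
  with Comp.IH(1) have "ys = ys'"
    by (auto simp: list_all2_conv_all_nth intro!: nth_equalityI)
  with Comp.IH(2) z show ?case by simp
next
  case (Mu f n xs)
  from Mu.prems have "eval f (z # xs) 0 \<and> (\<forall>m<z. \<exists>y. eval f (m # xs) (Suc y))"
    by (rule eval_elims) simp
  then have z: "eval f (z # xs) 0" "\<And>m. m < z \<Longrightarrow> \<exists>y. eval f (m # xs) (Suc y)"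
    by simp_all
  have "\<not> z < n" using Mu.IH(2) z(1) by fastforce
  moreover have "\<not> n < z" using Mu.IH(1) z(2) by fastforce
  ultimately show ?case by simp
next
  case Zero
  then show ?case by (rule eval_elims) simp
next
  case Succ
  then show ?case by (rule eval_elims) simp
next
  case Proj
  from Proj(2) show ?case by (rule eval_elims) simp
next
  case PrimRec_0
  from PrimRec_0.prems show ?case by (rule eval_elims) (rule PrimRec_0.IH)
next
  case (PrimRec_Suc f g n xs y w)
  from PrimRec_Suc.prems show ?case
    by (rule eval_elims) (use PrimRec_Suc.IH in blast)
qed

text \<open>Goedel numbering, through which formulas are passed to algorithms.\<close>

primrec goedel :: "fm \<Rightarrow> nat" where
  "goedel (Atom n) = prod_encode (0, n)"
| "goedel (And \<alpha> \<beta>) = prod_encode (1, prod_encode (goedel \<alpha>, goedel \<beta>))"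
| "goedel (Neg \<alpha>) = prod_encode (2, goedel \<alpha>)"
| "goedel (Box \<alpha>) = prod_encode (3, goedel \<alpha>)"

lemma goedel_inject: "goedel \<alpha> = goedel \<beta> \<longleftrightarrow> \<alpha> = \<beta>"
proof (induction \<alpha> arbitrary: \<beta>)
  case Atom
  then show ?case by (cases \<beta>) (simp_all add: prod_encode_eq)
next
  case And
  then show ?case by (cases \<beta>) (simp_all add: prod_encode_eq)
next
  case Neg
  then show ?case by (cases \<beta>) (simp_all add: prod_encode_eq)
next
  case Box
  then show ?case by (cases \<beta>) (simp_all add: prod_encode_eq)
qed

definition decidable :: "(fm \<Rightarrow> bool) \<Rightarrow> bool" where
  "decidable P \<longleftrightarrow> (\<exists>f. \<forall>\<alpha>. eval f [goedel \<alpha>] (if P \<alpha> then 1 else 0))"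

end

theory Submission imports Defs begin

text \<open>Read at a single state of an orthoframe, a sequent is a classical implication from the
  conjunction of its left side to the disjunction of its right side. A maximal underivable sequent
  over the formulas with code at most \<open>N\<close> and their negations determines such a state: the formulas
  of its left side are those true there. Two states are compatible if no formula is true in one while
  its negation is true in the other. Hence \<open>\<turnstile> \<alpha>\<close> is underivable iff some finite set of states, each
  satisfying local closure conditions, contains one in which \<open>\<alpha>\<close> is false. Only finitely many such
  sets exist for a given \<open>\<alpha>\<close>; coding them as bit vectors turns underivability into an arithmetical
  formula with bounded quantifiers only, which is recursive.\<close>

section \<open>Recursive functions of several variables\<close>

text \<open>The type \<open>'a\<close> is that of environments: \<open>F\<close> is computed from the values of the variables \<open>vs\<close>.
  Binding a variable extends the environment to a pair, so that closure properties under binders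
  are introduction rules whose schematic variables are higher-order patterns.\<close>

definition computable :: "('a \<Rightarrow> nat) list \<Rightarrow> ('a \<Rightarrow> nat) \<Rightarrow> bool" where
  "computable vs F \<longleftrightarrow> (\<exists>f. \<forall>a. eval f (map (\<lambda>v. v a) vs) (F a))"

definition decidable_rel :: "('a \<Rightarrow> nat) list \<Rightarrow> ('a \<Rightarrow> bool) \<Rightarrow> bool" where
  "decidable_rel vs P \<longleftrightarrow> computable vs (\<lambda>a. of_bool (P a))"

lemma computable_var:
  assumes "v \<in> set vs"
  shows "computable vs v"
proof -
  from assms obtain i where "i < length vs" "vs ! i = v" by (auto simp: in_set_conv_nth)
  then have "eval (Proj i) (map (\<lambda>v. v a) vs) (v a)" for a
    using eval.Proj[of i "map (\<lambda>v. v a) vs"] by simp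
  then show ?thesis unfolding computable_def by blast
qed

lemma computable_zero: "computable vs (\<lambda>_. 0)"
  unfolding computable_def by (blast intro: eval.Zero)

lemma computable_Suc:
  assumes "computable vs F"
  shows "computable vs (\<lambda>a. Suc (F a))"
proof -
  from assms obtain f where f: "\<And>a. eval f (map (\<lambda>v. v a) vs) (F a)"
    unfolding computable_def by blast
  have "eval (Comp Succ [f]) (map (\<lambda>v. v a) vs) (Suc (F a))" for a
    by (rule eval.Comp[where ys = "[F a]"]) (simp_all add: f eval.Succ)
  then show ?thesis unfolding computable_def by blast
qed

lemma computable_numeral: "computable vs (\<lambda>_. numeral k)"
proof -
  have "computable vs (\<lambda>_. n)" for n
    by (induction n) (auto intro: computable_zero computable_Suc)
  then show ?thesis .
qed

lemma computable_one: "computable vs (\<lambda>_. 1)"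
  using computable_Suc[OF computable_zero] by simp

text \<open>Recursion with parameters. The step sees the nested tuple \<open>(n, y, a)\<close> of
  counter, previous value and old environment, in the argument order of
  \<open>PrimRec\<close>.\<close>

lemma computable_rec_nat:
  assumes "computable vs B"
    and "computable (fst # (\<lambda>z. fst (snd z)) # map (\<lambda>v z. v (snd (snd z))) vs)
      (\<lambda>z. H (fst z) (fst (snd z)) (snd (snd z)))"
    and "computable vs L"
  shows "computable vs (\<lambda>a. rec_nat (B a) (\<lambda>n y. H n y a) (L a))"
proof -
  from assms(1) obtain b where b: "\<And>a. eval b (map (\<lambda>v. v a) vs) (B a)"
    unfolding computable_def by blast
  from assms(3) obtain l where l: "\<And>a. eval l (map (\<lambda>v. v a) vs) (L a)"
    unfolding computable_def by blast
  from assms(2) obtain h where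
    "\<And>z. eval h (map (\<lambda>v. v z) (fst # (\<lambda>z. fst (snd z)) # map (\<lambda>v z. v (snd (snd z))) vs))
      (H (fst z) (fst (snd z)) (snd (snd z)))"
    unfolding computable_def by blast
  from this[of "(n, y, a)" for n y a]
  have h: "eval h (n # y # map (\<lambda>v. v a) vs) (H n y a)" for n y a
    by (simp add: comp_def)
  have rec: "eval (PrimRec b h) (n # map (\<lambda>v. v a) vs) (rec_nat (B a) (\<lambda>n y. H n y a) n)" for n a
    by (induction n) (auto intro: eval.PrimRec_0 eval.PrimRec_Suc b h)
  \<comment> \<open>The bound comes first; the projections pass the variables on unchanged as
    parameters.\<close>
  let ?args = "l # map Proj [0..<length vs]"
  have "eval (Comp (PrimRec b h) ?args) (map (\<lambda>v. v a) vs)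
      (rec_nat (B a) (\<lambda>n y. H n y a) (L a))" for a
  proof (rule eval.Comp)
    show "list_all2 (\<lambda>g y. eval g (map (\<lambda>v. v a) vs) y) ?args (L a # map (\<lambda>v. v a) vs)"
      using l eval.Proj[of _ "map (\<lambda>v. v a) vs"]
      by (auto simp: list_all2_Cons list_all2_conv_all_nth[of _ "map Proj _"])
  qed (rule rec)
  then show ?thesis unfolding computable_def by blast
qed

text \<open>Change of environment along \<open>r\<close>; it lets the step of a recursion ignore its
  previous value.\<close>

lemma computable_comp:
  assumes "computable vs F" "\<And>v. v \<in> set vs \<Longrightarrow> computable ws (\<lambda>z. v (r z))"
  shows "computable ws (\<lambda>z. F (r z))"
proof -
  from assms(1) obtain f where f: "\<And>a. eval f (map (\<lambda>v. v a) vs) (F a)"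
    unfolding computable_def by blast
  from assms(2) have "\<forall>v \<in> set vs. \<exists>g. \<forall>z. eval g (map (\<lambda>w. w z) ws) (v (r z))"
    unfolding computable_def by blast
  then obtain g where g: "\<And>v z. v \<in> set vs \<Longrightarrow> eval (g v) (map (\<lambda>w. w z) ws) (v (r z))"
    by metis
  have "eval (Comp f (map g vs)) (map (\<lambda>w. w z) ws) (F (r z))" for z
    by (rule eval.Comp[where ys = "map (\<lambda>v. v (r z)) vs"])
      (simp_all add: f g list_all2_conv_all_nth)
  then show ?thesis unfolding computable_def by blast
qed

text \<open>\<open>computable_var\<close> stays outside: its conclusion matches every computability
  goal, so it is tried only where its membership premise is provable at once.\<close>

named_theorems comp
lemmas [comp] = computable_zero computable_one computable_numeral computable_Suc
  computable_rec_nat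

section \<open>Arithmetical functions\<close>

lemma computable_add [comp]:
  assumes "computable vs F" "computable vs G"
  shows "computable vs (\<lambda>a. F a + G a)"
proof -
  have eq: "m + n = rec_nat m (\<lambda>_. Suc) n" for m n
    by (induction n) simp_all
  show ?thesis
    unfolding eq by (rule comp assms | (rule computable_var, simp; fail))+
qed

lemma computable_diff [comp]:
  assumes "computable vs F" "computable vs G"
  shows "computable vs (\<lambda>a. F a - G a)"
proof -
  \<comment> \<open>A recursion whose step returns the counter is the predecessor; iterating it
    gives truncated subtraction.\<close>
  have pred: "rec_nat 0 (\<lambda>m _. m) n = n - 1" for n :: nat
    by (cases n) simp_all
  have eq: "m - n = rec_nat m (\<lambda>_ y. rec_nat 0 (\<lambda>m _. m) y) n" for m n :: nat
    by (induction n) (simp_all add: pred)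
  show ?thesis
    unfolding eq by (rule comp assms | (rule computable_var, simp; fail))+
qed

lemma computable_triangle [comp]:
  assumes "computable vs F"
  shows "computable vs (\<lambda>a. triangle (F a))"
proof -
  have eq: "triangle n = rec_nat 0 (\<lambda>m y. y + Suc m) n" for n
    by (induction n) simp_all
  show ?thesis
    unfolding eq by (rule comp assms | (rule computable_var, simp; fail))+
qed

lemma computable_prod_encode [comp]:
  assumes "computable vs F" "computable vs G"
  shows "computable vs (\<lambda>a. prod_encode (F a, G a))"
  unfolding prod_encode_def prod.case by (rule comp assms)+

lemma computable_power_2 [comp]:
  assumes "computable vs F"
  shows "computable vs (\<lambda>a. 2 ^ F a)"
proof -
  have eq: "2 ^ n = rec_nat (1 :: nat) (\<lambda>_ y. y + y) n" for n
    by (induction n) (simp_all add: mult_2)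
  show ?thesis
    unfolding eq by (rule comp assms | (rule computable_var, simp; fail))+
qed

lemma computable_mod_2 [comp]:
  assumes "computable vs F"
  shows "computable vs (\<lambda>a. F a mod 2)"
proof -
  have eq: "n mod 2 = rec_nat 0 (\<lambda>_ y. 1 - y) n" for n
  proof (induction n)
    case (Suc n)
    have "Suc n mod 2 = 1 - n mod 2" by presburger
    with Suc show ?case by simp
  qed simp
  show ?thesis
    unfolding eq by (rule comp assms | (rule computable_var, simp; fail))+
qed

lemma computable_div_power_2 [comp]:
  assumes "computable vs F" "computable vs G"
  shows "computable vs (\<lambda>a. F a div 2 ^ G a)"
proof -
  \<comment> \<open>Halving counts the odd numbers below \<open>n\<close>.\<close>
  have half: "n div 2 = rec_nat 0 (\<lambda>m y. y + m mod 2) n" for n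
  proof (induction n)
    case (Suc n)
    have "Suc n div 2 = n div 2 + n mod 2" by presburger
    with Suc show ?case by simp
  qed simp
  have eq: "m div 2 ^ n = rec_nat m (\<lambda>_ y. y div 2) n" for m n :: nat
    by (induction n) (simp_all add: power_Suc2 div_mult2_eq del: power_Suc)
  show ?thesis
    unfolding eq unfolding half by (rule comp assms | (rule computable_var, simp; fail))+
qed

section \<open>Connectives and bounded quantifiers\<close>

lemma decidable_rel_not [comp]:
  assumes "decidable_rel vs P"
  shows "decidable_rel vs (\<lambda>a. \<not> P a)"
proof -
  have eq: "of_bool (\<not> P a) = 1 - (of_bool (P a) :: nat)" for a by simp
  show ?thesis
    unfolding decidable_rel_def eq by (rule comp assms[unfolded decidable_rel_def])+
qed

lemma decidable_rel_zero [comp]: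
  assumes "computable vs F"
  shows "decidable_rel vs (\<lambda>a. F a = 0)"
proof -
  have eq: "of_bool (n = 0) = 1 - n" for n :: nat by simp
  show ?thesis unfolding decidable_rel_def eq by (rule comp assms)+
qed

lemma decidable_rel_le [comp]:
  assumes "computable vs F" "computable vs G"
  shows "decidable_rel vs (\<lambda>a. F a \<le> G a)"
  unfolding diff_is_0_eq[symmetric] by (rule comp assms)+

lemma decidable_rel_conj [comp]:
  assumes "decidable_rel vs P" "decidable_rel vs Q"
  shows "decidable_rel vs (\<lambda>a. P a \<and> Q a)"
proof -
  have eq: "P a \<and> Q a \<longleftrightarrow> of_bool (\<not> P a) + of_bool (\<not> Q a) = (0 :: nat)" for a by simp
  show ?thesis
    unfolding eq
    by (rule comp assms[THEN decidable_rel_not, unfolded decidable_rel_def])+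
qed

lemma decidable_rel_imp [comp]:
  assumes "decidable_rel vs P" "decidable_rel vs Q"
  shows "decidable_rel vs (\<lambda>a. P a \<longrightarrow> Q a)"
proof -
  have eq: "(P a \<longrightarrow> Q a) \<longleftrightarrow> \<not> (P a \<and> \<not> Q a)" for a by simp
  show ?thesis unfolding eq by (rule comp assms)+
qed

lemma decidable_rel_iff [comp]:
  assumes "decidable_rel vs P" "decidable_rel vs Q"
  shows "decidable_rel vs (\<lambda>a. P a \<longleftrightarrow> Q a)"
  unfolding iff_conv_conj_imp by (rule comp assms)+

lemma decidable_rel_ex [comp]:
  assumes "computable vs L"
    and "decidable_rel (fst # map (\<lambda>v z. v (snd z)) vs) (\<lambda>z. P (fst z) (snd z))"
  shows "decidable_rel vs (\<lambda>a. \<exists>n < L a. P n a)"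
proof -
  \<comment> \<open>Bounded search: \<open>y\<close> becomes 1 at the first witness and stays 1; the
    negated zero test brings the sum back to 0 or 1.\<close>
  have eq: "of_bool (\<exists>n < k. P n a) =
      rec_nat (0 :: nat) (\<lambda>n y. of_bool (\<not> y + of_bool (P n a) = 0)) k" for k a
  proof (induction k)
    case (Suc k)
    have "(\<exists>n < Suc k. P n a) \<longleftrightarrow> (\<exists>n < k. P n a) \<or> P k a" by (auto simp: less_Suc_eq)
    with Suc[symmetric] show ?case by simp
  qed simp
  let ?ws = "fst # (\<lambda>z. fst (snd z)) # map (\<lambda>v z. v (snd (snd z))) vs"
  \<comment> \<open>\<open>P\<close> is given on pairs \<open>(n, a)\<close> and is pulled back
    along the map that drops \<open>y\<close> from \<open>(n, y, a)\<close>.\<close>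
  have "computable ?ws (\<lambda>z. of_bool (P (fst (fst z, snd (snd z))) (snd (fst z, snd (snd z)))))"
    by (rule computable_comp[OF assms(2)[unfolded decidable_rel_def]]) (auto intro: computable_var)
  then have P: "computable ?ws (\<lambda>z. of_bool (P (fst z) (snd (snd z))))" by simp
  have "decidable_rel ?ws (\<lambda>z. \<not> fst (snd z) + of_bool (P (fst z) (snd (snd z))) = 0)"
    by (rule comp P | (rule computable_var, simp; fail))+
  note step = this[unfolded decidable_rel_def]
  show ?thesis
    unfolding decidable_rel_def eq by (rule computable_rec_nat computable_zero assms(1) step)+
qed

lemma decidable_rel_all [comp]:
  assumes "computable vs L"
    and "decidable_rel (fst # map (\<lambda>v z. v (snd z)) vs) (\<lambda>z. P (fst z) (snd z))"
  shows "decidable_rel vs (\<lambda>a. \<forall>n < L a. P n a)"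
proof -
  have eq: "(\<forall>n < L a. P n a) \<longleftrightarrow> \<not> (\<exists>n < L a. \<not> P n a)" for a by simp
  show ?thesis unfolding eq by (rule comp assms)+
qed

lemma decidable_rel_mem_set_decode [comp]:
  assumes "computable vs F" "computable vs G"
  shows "decidable_rel vs (\<lambda>a. F a \<in> set_decode (G a))"
proof -
  have eq: "m \<in> set_decode n \<longleftrightarrow> \<not> n div 2 ^ m mod 2 = 0" for m n
    by (auto simp: set_decode_def odd_iff_mod_2_eq_one)
  show ?thesis unfolding eq by (rule comp assms)+
qed

section \<open>Finite models\<close>

abbreviation and_code :: "nat \<Rightarrow> nat \<Rightarrow> nat" where
  "and_code a b \<equiv> prod_encode (1, prod_encode (a, b))"

abbreviation neg_code :: "nat \<Rightarrow> nat" where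
  "neg_code a \<equiv> prod_encode (2, a)"

abbreviation box_code :: "nat \<Rightarrow> nat" where
  "box_code a \<equiv> prod_encode (3, a)"

text \<open>A state is a pair: the first component codes the set of formulas true in it, the second the
  set of formulas whose negation is true. Only codes up to \<open>N\<close> matter.\<close>

definition compatible :: "nat \<Rightarrow> nat \<times> nat \<Rightarrow> nat \<times> nat \<Rightarrow> bool" where
  "compatible N w v \<longleftrightarrow> (\<forall>a < Suc N.
    \<not> (a \<in> set_decode (fst w) \<and> a \<in> set_decode (snd v)) \<and>
    \<not> (a \<in> set_decode (snd w) \<and> a \<in> set_decode (fst v)))"

text \<open>The canonical accessibility relation of modal logic, cut off at
  \<open>N\<close>.\<close>

definition access :: "nat \<Rightarrow> nat \<times> nat \<Rightarrow> nat \<times> nat \<Rightarrow> bool" where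
  "access N w v \<longleftrightarrow> (\<forall>a < Suc N. box_code a \<le> N \<longrightarrow> box_code a \<in> set_decode (fst w) \<longrightarrow>
    a \<in> set_decode (fst v))"

text \<open>Boxed formulas are two-valued, as (MEM) demands. Conjunction gets a clause for its truth
  only, because its negation may be true where that of neither conjunct is.\<close>

definition coherent :: "nat \<Rightarrow> nat \<times> nat \<Rightarrow> bool" where
  "coherent N w \<longleftrightarrow> (\<forall>a < Suc N.
    \<not> (a \<in> set_decode (fst w) \<and> a \<in> set_decode (snd w)) \<and>
    (neg_code a \<le> N \<longrightarrow>
      (neg_code a \<in> set_decode (fst w) \<longleftrightarrow> a \<in> set_decode (snd w)) \<and>
      (neg_code a \<in> set_decode (snd w) \<longleftrightarrow> a \<in> set_decode (fst w))) \<and>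
    (box_code a \<le> N \<longrightarrow>
      (box_code a \<in> set_decode (snd w) \<longleftrightarrow> \<not> box_code a \<in> set_decode (fst w))) \<and>
    (\<forall>b < Suc N. and_code a b \<le> N \<longrightarrow>
      (and_code a b \<in> set_decode (fst w) \<longleftrightarrow>
        a \<in> set_decode (fst w) \<and> b \<in> set_decode (fst w))))"

text \<open>The conditions involving other states: each clause supplies the witness against a
  formula, a negation or a boxed formula not recorded as true. The first makes truth sets closed
  under double orthocomplement.\<close>

definition saturated :: "nat \<Rightarrow> (nat \<times> nat) set \<Rightarrow> nat \<times> nat \<Rightarrow> bool" where
  "saturated N W w \<longleftrightarrow> (\<forall>a < Suc N.
    (\<not> a \<in> set_decode (fst w) \<longrightarrow> (\<exists>v \<in> W. compatible N w v \<and> a \<in> set_decode (snd v))) \<and>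
    (\<not> a \<in> set_decode (snd w) \<longrightarrow> (\<exists>v \<in> W. compatible N w v \<and> a \<in> set_decode (fst v))) \<and>
    (box_code a \<le> N \<longrightarrow> \<not> box_code a \<in> set_decode (fst w) \<longrightarrow>
      (\<exists>v \<in> W. access N w v \<and> \<not> a \<in> set_decode (fst v))))"

definition is_model :: "nat \<Rightarrow> (nat \<times> nat) set \<Rightarrow> bool" where
  "is_model N W \<longleftrightarrow> (\<forall>w \<in> W. coherent N w \<and> saturated N W w)"

text \<open>A positive tag makes the inequality strict. Hence immediate subformulas have smaller
  codes, which keeps them below \<open>N\<close> and makes \<open>decode\<close> terminate.\<close>

lemma less_prod_encode: "m < prod_encode (Suc k, m)"
  using le_prod_encode_2[of m k] by (simp add: prod_encode_def)

lemma less_and_code: "a < and_code a b" "b < and_code a b"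
  using le_less_trans[OF le_prod_encode_1 less_prod_encode[of _ 0]]
    le_less_trans[OF le_prod_encode_2 less_prod_encode[of _ 0]]
  by simp_all

lemma less_neg_code: "a < neg_code a"
  using less_prod_encode[of a 1] by (simp only: Suc_1)

lemma less_box_code: "a < box_code a"
  using less_prod_encode[of a 2] by (simp only: Suc_numeral add_num_simps)

lemma compatible_sym: "compatible N w v \<longleftrightarrow> compatible N v w"
  unfolding compatible_def by blast

lemma compatible_refl: "coherent N w \<Longrightarrow> compatible N w w"
  unfolding compatible_def coherent_def by blast

text \<open>\<open>access\<close> depends only on the boxed formulas true at its first state.
  Coherence makes these two-valued, so compatible states cannot differ on them.\<close>

lemma access_compatible:
  assumes "coherent N w" "coherent N v" "compatible N w v"
  shows "access N w = access N v"
proof -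
  have "box_code a \<in> set_decode (fst w) \<longleftrightarrow> box_code a \<in> set_decode (fst v)"
    if "box_code a \<le> N" for a
  proof -
    have "a < Suc N" "box_code a < Suc N" using that less_box_code[of a] by simp_all
    then show ?thesis using assms that unfolding coherent_def compatible_def by metis
  qed
  then show ?thesis unfolding access_def by (auto simp: fun_eq_iff)
qed

text \<open>Orthoframe semantics for \<open>Neg\<close>, Kripke semantics for \<open>Box\<close>.
  All formulas are covered, since cuts may use codes above \<open>N\<close>; atoms beyond the bound
  are false everywhere.\<close>

primrec sat :: "nat \<Rightarrow> (nat \<times> nat) set \<Rightarrow> nat \<times> nat \<Rightarrow> fm \<Rightarrow> bool" where
  "sat N W w (Atom n) \<longleftrightarrow> goedel (Atom n) \<le> N \<and> goedel (Atom n) \<in> set_decode (fst w)"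
| "sat N W w (And \<alpha> \<beta>) \<longleftrightarrow> sat N W w \<alpha> \<and> sat N W w \<beta>"
| "sat N W w (Neg \<alpha>) \<longleftrightarrow> (\<forall>v \<in> W. compatible N w v \<longrightarrow> \<not> sat N W v \<alpha>)"
| "sat N W w (Box \<alpha>) \<longleftrightarrow> (\<forall>v \<in> W. access N w v \<longrightarrow> sat N W v \<alpha>)"

text \<open>Behind the soundness of (MEM): a false boxed formula is false at all compatible states,
  so its negation is true.\<close>

lemma sat_Box_compatible:
  assumes "is_model N W" "w \<in> W" "v \<in> W" "compatible N w v"
  shows "sat N W w (Box \<alpha>) \<longleftrightarrow> sat N W v (Box \<alpha>)"
proof -
  have "coherent N w" "coherent N v" using assms(1-3) unfolding is_model_def by blast+
  then have "access N w = access N v" using assms(4) by (rule access_compatible)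
  then show ?thesis by simp
qed

text \<open>Truth sets are closed under double orthocomplement, which makes double negation sound.\<close>

lemma not_sat_compatible_Neg:
  assumes "is_model N W" "w \<in> W" "\<not> sat N W w \<alpha>"
  shows "\<exists>v \<in> W. compatible N w v \<and> sat N W v (Neg \<alpha>)"
  using assms(2,3)
proof (induction \<alpha> arbitrary: w)
  case (Atom n)
  have w: "coherent N w" "saturated N W w"
    using assms(1) Atom.prems unfolding is_model_def by auto
  show ?case
  proof (cases "goedel (Atom n) \<le> N")
    case True
    with Atom.prems have "goedel (Atom n) < Suc N" "\<not> goedel (Atom n) \<in> set_decode (fst w)"
      by simp_all
    with w(2) obtain v where "v \<in> W" "compatible N w v" "goedel (Atom n) \<in> set_decode (snd v)"
      unfolding saturated_def by blast
    then show ?thesis using True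
      by (intro bexI[of _ v]) (auto simp: compatible_def less_Suc_eq_le)
  next
    case False
    \<comment> \<open>An atom beyond the bound is false everywhere, so \<open>w\<close> itself
      satisfies its negation.\<close>
    then show ?thesis using compatible_refl[OF w(1)] Atom.prems by (intro bexI[of _ w]) auto
  qed
next
  case (And \<alpha> \<beta>)
  then show ?case by fastforce
next
  case (Neg \<alpha>)
  then obtain v where "v \<in> W" "compatible N w v" "sat N W v \<alpha>" by auto
  then show ?case using compatible_sym by (intro bexI[of _ v]) auto
next
  case (Box \<alpha>)
  \<comment> \<open>Falsity of a boxed formula spreads to all compatible states, so \<open>w\<close>
    is its own witness.\<close>
  have "\<not> sat N W v (Box \<alpha>)" if "v \<in> W" "compatible N w v" for v
    using sat_Box_compatible[OF assms(1) Box.prems(1) that] Box.prems(2) by blast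
  then have "sat N W w (Neg (Box \<alpha>))" unfolding sat.simps(3) by blast
  moreover have "compatible N w w"
    using assms(1) Box.prems(1) compatible_refl unfolding is_model_def by blast
  ultimately show ?case using Box.prems(1) by blast
qed

text \<open>The truth lemma. Coherence settles conjunctions; recorded negations and boxes are true
  by the definitions of \<open>compatible\<close> and \<open>access\<close>, and saturation refutes
  the others.\<close>

lemma sat_iff_mem:
  assumes "is_model N W" "w \<in> W" "goedel \<alpha> \<le> N"
  shows "sat N W w \<alpha> \<longleftrightarrow> goedel \<alpha> \<in> set_decode (fst w)"
  using assms(2,3)
proof (induction \<alpha> arbitrary: w)
  case (Atom n)
  then show ?case by simp
next
  case (And \<alpha> \<beta>)
  then have le: "and_code (goedel \<alpha>) (goedel \<beta>) \<le> N" by simp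
  then have lt: "goedel \<alpha> < Suc N" "goedel \<beta> < Suc N"
    using less_and_code[where a = "goedel \<alpha>" and b = "goedel \<beta>"] by simp_all
  have "coherent N w" using assms(1) And.prems unfolding is_model_def by blast
  then have "and_code (goedel \<alpha>) (goedel \<beta>) \<in> set_decode (fst w) \<longleftrightarrow>
      goedel \<alpha> \<in> set_decode (fst w) \<and> goedel \<beta> \<in> set_decode (fst w)"
    using lt le unfolding coherent_def by blast
  then show ?case using And lt by simp
next
  case (Neg \<alpha>)
  then have le: "neg_code (goedel \<alpha>) \<le> N" by simp
  then have lt: "goedel \<alpha> < Suc N" using less_neg_code[of "goedel \<alpha>"] by simp
  have w: "coherent N w" "saturated N W w"
    using assms(1) Neg.prems unfolding is_model_def by auto
  \<comment> \<open>Saturation speaks of the second component; coherence then carries the result to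
    the first.\<close>
  have "sat N W w (Neg \<alpha>) \<longleftrightarrow> goedel \<alpha> \<in> set_decode (snd w)"
  proof
    assume "sat N W w (Neg \<alpha>)"
    then have "\<not> (\<exists>v \<in> W. compatible N w v \<and> goedel \<alpha> \<in> set_decode (fst v))"
      using Neg.IH lt by auto
    then show "goedel \<alpha> \<in> set_decode (snd w)"
      using w(2) lt unfolding saturated_def by blast
  next
    assume "goedel \<alpha> \<in> set_decode (snd w)"
    then show "sat N W w (Neg \<alpha>)"
      using Neg.IH lt by (auto simp: compatible_def)
  qed
  then show ?case using w(1) lt le unfolding coherent_def by simp
next
  case (Box \<alpha>)
  then have le: "box_code (goedel \<alpha>) \<le> N" by simp
  then have lt: "goedel \<alpha> < Suc N" using less_box_code[of "goedel \<alpha>"] by simp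
  have w: "saturated N W w" using assms(1) Box.prems unfolding is_model_def by auto
  show ?case
  proof
    assume "sat N W w (Box \<alpha>)"
    then have "\<not> (\<exists>v \<in> W. access N w v \<and> \<not> goedel \<alpha> \<in> set_decode (fst v))"
      using Box.IH lt by auto
    then show "goedel (Box \<alpha>) \<in> set_decode (fst w)"
      using w lt le unfolding saturated_def by auto
  next
    assume "goedel (Box \<alpha>) \<in> set_decode (fst w)"
    then show "sat N W w (Box \<alpha>)"
      using Box.IH lt le by (auto simp: access_def)
  qed
qed

section \<open>Soundness\<close>

primrec holds :: "nat \<Rightarrow> (nat \<times> nat) set \<Rightarrow> nat \<times> nat \<Rightarrow> sequent \<Rightarrow> bool" where
  "holds N W w (\<Gamma> \<turnstile> \<Delta>) \<longleftrightarrow> fBall \<Gamma> (sat N W w) \<longrightarrow> fBex \<Delta> (sat N W w)"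

lemma sat_Neg_Neg:
  assumes "is_model N W" "w \<in> W"
  shows "sat N W w (Neg (Neg \<alpha>)) \<longleftrightarrow> sat N W w \<alpha>"
proof
  assume "sat N W w (Neg (Neg \<alpha>))"
  then show "sat N W w \<alpha>" using not_sat_compatible_Neg[OF assms, of \<alpha>] by auto
next
  assume "sat N W w \<alpha>"
  then show "sat N W w (Neg (Neg \<alpha>))" using assms(2) compatible_sym by auto
qed

text \<open>The upper sequents are assumed at all states of \<open>W\<close>, since
  \<open>NegR\<close> and \<open>K\<close> evaluate them at states other than
  \<open>w\<close>.\<close>

lemma inference_holds:
  assumes "is_model N W" "inference ps s" "\<And>p w. p \<in> set ps \<Longrightarrow> w \<in> W \<Longrightarrow> holds N W w p" "w \<in> W"
  shows "holds N W w s"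
proof -
  note nn = sat_Neg_Neg[OF assms(1) \<open>w \<in> W\<close>]
  from assms(2,3) show ?thesis
  proof (induction rule: inference.induct)
    case (AX \<alpha>)
    show ?case by simp
  next
    case (MEM \<Gamma> \<alpha>)
    have "sat N W w (Neg (Box \<alpha>))" if "\<not> sat N W w (Box \<alpha>)"
      unfolding sat.simps(3)
    proof (intro ballI impI)
      fix v assume "v \<in> W" "compatible N w v"
      then show "\<not> sat N W v (Box \<alpha>)"
        using sat_Box_compatible[OF assms(1,4)] that by blast
    qed
    then show ?case by (auto simp del: sat.simps)
  next
    case (WKN \<Gamma> \<Delta> \<Pi> \<Sigma>)
    from WKN[OF _ assms(4)] have "holds N W w (\<Gamma> \<turnstile> \<Delta>)" by (simp del: holds.simps)
    then show ?case
      unfolding holds.simps fBall_funion fBex_funion FSet.ball_simps(6) FSet.bex_simps(4) by blast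
  next
    case (CUT \<Gamma>\<^sub>1 \<alpha> \<Delta>\<^sub>1 \<Gamma>\<^sub>2 \<Delta>\<^sub>2)
    from CUT[OF _ assms(4)] have "holds N W w (\<Gamma>\<^sub>1 \<turnstile> finsert \<alpha> \<Delta>\<^sub>1)" "holds N W w (finsert \<alpha> \<Gamma>\<^sub>2 \<turnstile> \<Delta>\<^sub>2)"
      by (simp_all del: holds.simps)
    then show ?case
      unfolding holds.simps fBall_funion fBex_funion FSet.ball_simps(6) FSet.bex_simps(4) by blast
  next
    case (AndL1 \<alpha> \<Gamma> \<Delta> \<beta>)
    from AndL1[OF _ assms(4)] show ?case by simp
  next
    case (AndL2 \<beta> \<Gamma> \<Delta> \<alpha>)
    from AndL2[OF _ assms(4)] show ?case by simp
  next
    case (AndR \<Gamma> \<alpha> \<Delta> \<beta>)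
    from AndR[OF _ assms(4)] have "holds N W w (\<Gamma> \<turnstile> finsert \<alpha> \<Delta>)" "holds N W w (\<Gamma> \<turnstile> finsert \<beta> \<Delta>)"
      by (simp_all del: holds.simps)
    then show ?case by auto
  next
    case (NegL \<Gamma> \<alpha> \<Delta>)
    have "\<not> sat N W w \<alpha>" if "sat N W w (Neg \<alpha>)"
      using assms(1,4) compatible_refl that unfolding is_model_def by auto
    with NegL[OF _ assms(4)] show ?case by (auto simp del: sat.simps)
  next
    case (NegR \<alpha> \<Delta>)
    have "sat N W w (Neg \<alpha>)" if w: "fBall \<Delta> (\<lambda>\<delta>. sat N W w (Neg \<delta>))"
      unfolding sat.simps
    proof (intro ballI impI notI)
      fix v
      assume v: "v \<in> W" "compatible N w v" "sat N W v \<alpha>"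
      \<comment> \<open>The upper sequent makes some \<open>\<delta>\<close> true at
        \<open>v\<close>, against the truth of \<open>Neg \<delta>\<close> at the compatible state
        \<open>w\<close>.\<close>
      from NegR[OF _ v(1)] v(3) obtain \<delta> where "\<delta> |\<in>| \<Delta>" "sat N W v \<delta>" by auto
      then have "sat N W w (Neg \<delta>)" using fbspec[OF w] by blast
      then show False using v \<open>sat N W v \<delta>\<close> by simp
    qed
    then show ?case by (simp del: sat.simps)
  next
    case (NegNegL \<alpha> \<Gamma> \<Delta>)
    from NegNegL[OF _ assms(4)] show ?case by (simp add: nn del: sat.simps)
  next
    case (NegNegR \<Gamma> \<alpha> \<Delta>)
    from NegNegR[OF _ assms(4)] show ?case by (simp add: nn del: sat.simps)
  next
    case (K \<Gamma> \<alpha>)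
    have "sat N W w (Box \<alpha>)" if w: "fBall \<Gamma> (\<lambda>\<gamma>. sat N W w (Box \<gamma>))"
      unfolding sat.simps
    proof (intro ballI impI)
      fix v
      assume v: "v \<in> W" "access N w v"
      have "fBall \<Gamma> (sat N W v)"
      proof (rule fBallI)
        fix \<gamma> assume "\<gamma> |\<in>| \<Gamma>"
        with w have "sat N W w (Box \<gamma>)" by (rule fbspec)
        then show "sat N W v \<gamma>" using v by simp
      qed
      then show "sat N W v \<alpha>" using K[OF _ v(1)] by simp
    qed
    then show ?case by (simp del: sat.simps)
  qed
qed

text \<open>Course-of-values induction along a derivation gives derivability the induction principle
  of a least set closed under the rules.\<close>

lemma derivable_induct [consumes 1, case_names inference]:
  assumes "derivable s" "\<And>ps s. inference ps s \<Longrightarrow> (\<And>p. p \<in> set ps \<Longrightarrow> P p) \<Longrightarrow> P s"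
  shows "P s"
proof -
  from assms(1) obtain ds where ds: "derivation ds" "ds \<noteq> []" "last ds = s"
    unfolding derivable_def by blast
  have "P (ds ! i)" if "i < length ds" for i
    using that
  proof (induction i rule: less_induct)
    case (less i)
    then obtain ps where ps: "set ps \<subseteq> set (take i ds)" "inference ps (ds ! i)"
      using ds(1) unfolding derivation_def by blast
    have "P p" if "p \<in> set ps" for p
      using that ps(1) less by (fastforce simp: in_set_conv_nth)
    with ps(2) show ?case by (rule assms(2))
  qed
  from this[of "length ds - 1"] ds show ?thesis by (simp add: last_conv_nth)
qed

lemma derivable_holds:
  assumes "is_model N W" "derivable s" "w \<in> W"
  shows "holds N W w s"
  using assms(2,3) by (induction arbitrary: w rule: derivable_induct) (rule inference_holds[OF assms(1)])

section \<open>Completeness\<close>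

lemma derivation_append:
  assumes "derivation ds" "derivation es"
  shows "derivation (ds @ es)"
  unfolding derivation_def
proof (intro allI impI)
  fix i assume i: "i < length (ds @ es)"
  show "\<exists>ps. set ps \<subseteq> set (take i (ds @ es)) \<and> inference ps ((ds @ es) ! i)"
  proof (cases "i < length ds")
    case True
    then show ?thesis using assms(1) unfolding derivation_def by (auto simp: nth_append)
  next
    case False
    then obtain ps where "set ps \<subseteq> set (take (i - length ds) es)"
      "inference ps (es ! (i - length ds))"
      using i assms(2) unfolding derivation_def by (metis add_diff_inverse_nat length_append
          nat_add_left_cancel_less)
    then show ?thesis using False by (auto simp: nth_append intro!: exI[of _ ps])
  qed
qed

text \<open>Derivations of the upper sequents are concatenated and the lower one is
  appended.\<close>

lemma derivable_inference:
  assumes "inference ps s" "\<And>p. p \<in> set ps \<Longrightarrow> derivable p"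
  shows "derivable s"
proof -
  from assms(2) have "\<exists>ds. derivation ds \<and> set ps \<subseteq> set ds"
  proof (induction ps)
    case Nil
    show ?case by (rule exI[of _ "[]"]) (simp add: derivation_def)
  next
    case (Cons p ps)
    then obtain ds where "derivation ds" "set ps \<subseteq> set ds" by auto
    moreover obtain es where "derivation es" "es \<noteq> []" "last es = p"
      using Cons.prems[of p] unfolding derivable_def by auto
    ultimately have "derivation (ds @ es)" "set (p # ps) \<subseteq> set (ds @ es)"
      by (auto simp: derivation_append)
    then show ?case by blast
  qed
  then obtain ds where ds: "derivation ds" "set ps \<subseteq> set ds" by blast
  have "derivation (ds @ [s])"
    unfolding derivation_def
  proof (intro allI impI)
    fix i assume "i < length (ds @ [s])"
    then consider "i < length ds" | "i = length ds" by force
    then show "\<exists>ps. set ps \<subseteq> set (take i (ds @ [s])) \<and> inference ps ((ds @ [s]) ! i)"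
      using ds assms(1) by cases (auto simp: derivation_def nth_append)
  qed
  then show ?thesis unfolding derivable_def by (intro exI[of _ "ds @ [s]"]) simp
qed

lemma derivable_WKN:
  assumes "derivable (\<Gamma> \<turnstile> \<Delta>)" "\<Gamma> |\<subseteq>| \<Gamma>'" "\<Delta> |\<subseteq>| \<Delta>'"
  shows "derivable (\<Gamma>' \<turnstile> \<Delta>')"
proof -
  have "inference [\<Gamma> \<turnstile> \<Delta>] (\<Gamma>' |\<union>| \<Gamma> \<turnstile> \<Delta> |\<union>| \<Delta>')" by (rule inference.WKN)
  moreover have "\<Gamma>' |\<union>| \<Gamma> = \<Gamma>'" "\<Delta> |\<union>| \<Delta>' = \<Delta>'" using assms(2,3) by blast+
  ultimately show ?thesis using assms(1) derivable_inference by fastforce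
qed

lemma derivable_CUT:
  assumes "derivable (\<Gamma> \<turnstile> finsert \<alpha> \<Delta>)" "derivable (finsert \<alpha> \<Gamma> \<turnstile> \<Delta>)"
  shows "derivable (\<Gamma> \<turnstile> \<Delta>)"
  using derivable_inference[OF inference.CUT[of \<Gamma> \<alpha> \<Delta> \<Gamma> \<Delta>]] assms by auto

lemma derivable_AX:
  assumes "\<alpha> |\<in>| \<Gamma>" "\<alpha> |\<in>| \<Delta>"
  shows "derivable (\<Gamma> \<turnstile> \<Delta>)"
  using derivable_WKN[OF derivable_inference[OF inference.AX]] assms by simp

lemma derivable_inference1:
  assumes "inference [p] s" "derivable p"
  shows "derivable s"
  using derivable_inference[OF assms(1)] assms(2) by simp

text \<open>Underivable sequents covering \<open>U\<close> play the role of maximal consistent sets.\<close>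

lemma Lindenbaum:
  assumes "\<not> derivable (\<Gamma> \<turnstile> \<Delta>)"
  shows "\<exists>G D. \<Gamma> |\<subseteq>| G \<and> \<Delta> |\<subseteq>| D \<and> U |\<subseteq>| G |\<union>| D \<and> \<not> derivable (G \<turnstile> D)"
proof (induction U)
  case empty
  then show ?case using assms by blast
next
  case (insert x U)
  then obtain G D where GD: "\<Gamma> |\<subseteq>| G" "\<Delta> |\<subseteq>| D" "U |\<subseteq>| G |\<union>| D" "\<not> derivable (G \<turnstile> D)"
    by blast
  \<comment> \<open>Otherwise a cut on \<open>x\<close> would derive
    \<open>G \<turnstile> D\<close>.\<close>
  then consider "\<not> derivable (G \<turnstile> finsert x D)" | "\<not> derivable (finsert x G \<turnstile> D)"
    using derivable_CUT by blast
  then show ?case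
  proof cases
    case 1
    then show ?thesis using GD by (intro exI[of _ G] exI[of _ "finsert x D"]) auto
  next
    case 2
    then show ?thesis using GD by (intro exI[of _ "finsert x G"] exI[of _ D]) auto
  qed
qed

text \<open>A total inverse of the Goedel numbering; making it compositional on all numbers
  spares the model conditions a test for being a code.\<close>

function decode :: "nat \<Rightarrow> fm" where
  "decode n = (let (k, m) = prod_decode n in
    if k = 1 then And (decode (fst (prod_decode m))) (decode (snd (prod_decode m)))
    else if k = 2 then Neg (decode m)
    else if k = 3 then Box (decode m)
    else Atom m)"
  by auto
termination
proof (relation "measure id")
  fix n k m :: nat and p
  assume "p = prod_decode n" "(k, m) = p"
  then have n: "n = prod_encode (k, m)" by (metis prod_decode_inverse)
  {
    assume "k = 1"
    then show "(fst (prod_decode m), n) \<in> measure id" "(snd (prod_decode m), n) \<in> measure id"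
      using n less_and_code[where a = "fst (prod_decode m)" and b = "snd (prod_decode m)"] by simp_all
  }
  { assume "k = 2" then show "(m, n) \<in> measure id" using n less_neg_code by simp }
  { assume "k = 3" then show "(m, n) \<in> measure id" using n less_box_code by simp }
qed simp

declare decode.simps [simp del]

lemma decode_code [simp]:
  "decode (prod_encode (0, n)) = Atom n"
  "decode (and_code a b) = And (decode a) (decode b)"
  "decode (neg_code a) = Neg (decode a)"
  "decode (box_code a) = Box (decode a)"
  by (subst decode.simps, simp)+

lemma decode_goedel [simp]: "decode (goedel \<alpha>) = \<alpha>"
  by (induction \<alpha>) (simp_all flip: One_nat_def)

definition decoded_upto :: "nat \<Rightarrow> fm fset" where
  "decoded_upto N = fset_of_list (map decode [0..<Suc N])"

lemma decode_mem_decoded_upto: "a < Suc N \<Longrightarrow> decode a |\<in>| decoded_upto N"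
  unfolding decoded_upto_def by (simp add: fset_of_list_elem del: upt_Suc)

text \<open>Negations are added because the second component of a state records them even where
  their codes exceed \<open>N\<close>.\<close>

definition formulas_upto :: "nat \<Rightarrow> fm fset" where
  "formulas_upto N = decoded_upto N |\<union>| Neg |`| decoded_upto N"

lemma mem_formulas_upto:
  assumes "a \<le> N"
  shows "decode a |\<in>| formulas_upto N" "Neg (decode a) |\<in>| formulas_upto N"
  using assms decode_mem_decoded_upto[of a N] unfolding formulas_upto_def by simp_all

section \<open>The canonical model\<close>

definition consistent :: "nat \<Rightarrow> fm fset \<Rightarrow> fm fset \<Rightarrow> bool" where
  "consistent N G D \<longleftrightarrow> formulas_upto N |\<subseteq>| G |\<union>| D \<and> \<not> derivable (G \<turnstile> D)"

lemma consistent_extend: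
  assumes "\<not> derivable (\<Gamma> \<turnstile> \<Delta>)"
  obtains G D where "\<Gamma> |\<subseteq>| G" "\<Delta> |\<subseteq>| D" "consistent N G D"
  using Lindenbaum[OF assms] unfolding consistent_def by blast

text \<open>\<open>G\<close> may contain further formulas, which are forgotten here; hence only
  finitely many states arise.\<close>

definition state :: "nat \<Rightarrow> fm fset \<Rightarrow> nat \<times> nat" where
  "state N G = (set_encode {a. a < Suc N \<and> decode a |\<in>| G},
    set_encode {a. a < Suc N \<and> Neg (decode a) |\<in>| G})"

lemma set_decode_state [simp]:
  "set_decode (fst (state N G)) = {a. a < Suc N \<and> decode a |\<in>| G}"
  "set_decode (snd (state N G)) = {a. a < Suc N \<and> Neg (decode a) |\<in>| G}"
  by (simp_all add: state_def)

definition canonical :: "nat \<Rightarrow> (nat \<times> nat) set" where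
  "canonical N = {state N G |G. \<exists>D. consistent N G D}"

text \<open>Were \<alpha> missing from \<open>G\<close>, it would lie in \<open>D\<close>, and
  weakening would derive \<open>G \<turnstile> D\<close>.\<close>

lemma consistent_deduct:
  assumes "consistent N G D" "derivable (\<Gamma> \<turnstile> {|\<alpha>|})" "\<Gamma> |\<subseteq>| G" "\<alpha> |\<in>| formulas_upto N"
  shows "\<alpha> |\<in>| G"
proof (rule ccontr)
  assume "\<alpha> |\<notin>| G"
  then have "\<alpha> |\<in>| D" using assms(1,4) unfolding consistent_def by auto
  then show False
    using derivable_WKN[OF assms(2,3), of D] assms(1) unfolding consistent_def by simp
qed

lemma consistent_disjoint:
  assumes "consistent N G D" "\<alpha> |\<in>| G"
  shows "\<alpha> |\<notin>| D"
  using assms derivable_AX unfolding consistent_def by blast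

lemma consistent_not_Neg:
  assumes "consistent N G D" "\<alpha> |\<in>| G"
  shows "Neg \<alpha> |\<notin>| G"
proof
  assume "Neg \<alpha> |\<in>| G"
  have "derivable ({|Neg \<alpha>, \<alpha>|} \<turnstile> {||})"
    by (rule derivable_inference1[OF inference.NegL]) (simp add: derivable_AX)
  then have "derivable (G \<turnstile> D)"
    by (rule derivable_WKN) (use \<open>Neg \<alpha> |\<in>| G\<close> assms(2) in auto)
  then show False using assms(1) unfolding consistent_def by blast
qed

lemma derivable_Neg_Neg: "derivable ({|Neg (Neg \<alpha>)|} \<turnstile> {|\<alpha>|})" "derivable ({|\<alpha>|} \<turnstile> {|Neg (Neg \<alpha>)|})"
  by (rule derivable_inference1[OF inference.NegNegL] derivable_inference1[OF inference.NegNegR],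
      simp add: derivable_AX)+

text \<open>Each member of \<open>A\<close> yields its double negation, which can thus be cut. Such
  double negations arise when (\<not>r) is applied to negations of members of
  \<open>G\<close>.\<close>

lemma derivable_drop_Neg_Neg:
  assumes "A |\<subseteq>| G" "derivable (G |\<union>| (\<lambda>\<beta>. Neg (Neg \<beta>)) |`| A \<turnstile> \<Delta>)"
  shows "derivable (G \<turnstile> \<Delta>)"
  using assms
proof (induction A)
  case (insert \<alpha> A)
  have "derivable (G |\<union>| (\<lambda>\<beta>. Neg (Neg \<beta>)) |`| A \<turnstile> finsert (Neg (Neg \<alpha>)) \<Delta>)"
    by (rule derivable_WKN[OF derivable_Neg_Neg(2)]) (use insert.prems(1) in auto)
  then have "derivable (G |\<union>| (\<lambda>\<beta>. Neg (Neg \<beta>)) |`| A \<turnstile> \<Delta>)"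
    by (rule derivable_CUT) (use insert.prems(2) in simp)
  then show ?case using insert by simp
qed simp

text \<open>Contraposition of (\<not>r): \<alpha> goes to the left, and to the right go formulas
  whose absence from the new state ensures compatibility.\<close>

lemma consistent_compatible:
  assumes "consistent N G D" "\<not> derivable (G \<turnstile> {|Neg \<alpha>|})"
  obtains G' D' where "consistent N G' D'" "compatible N (state N G) (state N G')" "\<alpha> |\<in>| G'"
proof -
  \<comment> \<open>These serve the second component of \<open>state N G\<close>; the negations of
    members of \<open>G\<close> serve the first.\<close>
  define G1 where "G1 = ffilter (\<lambda>\<beta>. Neg \<beta> |\<in>| G) (decoded_upto N)"
  have "\<not> derivable ({|\<alpha>|} \<turnstile> Neg |`| G |\<union>| G1)"
  proof
    assume "derivable ({|\<alpha>|} \<turnstile> Neg |`| G |\<union>| G1)"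
    then have "derivable (Neg |`| (Neg |`| G |\<union>| G1) \<turnstile> {|Neg \<alpha>|})"
      by (rule derivable_inference1[OF inference.NegR])
    \<comment> \<open>Negating the right side gives double negations of members of \<open>G\<close>
      and, from \<open>G1\<close>, members of \<open>G\<close>.\<close>
    then have "derivable (G |\<union>| (\<lambda>\<beta>. Neg (Neg \<beta>)) |`| G \<turnstile> {|Neg \<alpha>|})"
      by (rule derivable_WKN) (auto simp: G1_def)
    then show False using assms(2) derivable_drop_Neg_Neg[of G G] by blast
  qed
  then obtain G' D' where G':
    "{|\<alpha>|} |\<subseteq>| G'" "Neg |`| G |\<union>| G1 |\<subseteq>| D'" "consistent N G' D'"
    by (rule consistent_extend)
  have "compatible N (state N G) (state N G')"
    unfolding compatible_def
  proof (intro allI impI)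
    fix a assume a: "a < Suc N"
    have "Neg (decode a) |\<notin>| G'" if "decode a |\<in>| G"
      using that G'(2) consistent_disjoint[OF G'(3)] by blast
    moreover have "decode a |\<notin>| G'" if "Neg (decode a) |\<in>| G"
    proof -
      have "decode a |\<in>| G1" using that a decode_mem_decoded_upto unfolding G1_def by simp
      then show ?thesis using G'(2) consistent_disjoint[OF G'(3)] by blast
    qed
    ultimately show "\<not> (a \<in> set_decode (fst (state N G)) \<and> a \<in> set_decode (snd (state N G'))) \<and>
        \<not> (a \<in> set_decode (snd (state N G)) \<and> a \<in> set_decode (fst (state N G')))"
      by auto
  qed
  then show ?thesis using that G' by blast
qed

lemma consistent_Neg_Neg:
  assumes "consistent N G D" "\<alpha> |\<in>| formulas_upto N" "Neg (Neg \<alpha>) |\<in>| formulas_upto N"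
  shows "Neg (Neg \<alpha>) |\<in>| G \<longleftrightarrow> \<alpha> |\<in>| G"
proof
  assume "Neg (Neg \<alpha>) |\<in>| G"
  then show "\<alpha> |\<in>| G"
    by (intro consistent_deduct[OF assms(1) derivable_Neg_Neg(1) _ assms(2)]) simp
next
  assume "\<alpha> |\<in>| G"
  then show "Neg (Neg \<alpha>) |\<in>| G"
    by (intro consistent_deduct[OF assms(1) derivable_Neg_Neg(2) _ assms(3)]) simp
qed

lemma consistent_Neg_Box:
  assumes "consistent N G D" "Box \<alpha> |\<in>| formulas_upto N" "Neg (Box \<alpha>) |\<in>| formulas_upto N"
  shows "Neg (Box \<alpha>) |\<in>| G \<longleftrightarrow> Box \<alpha> |\<notin>| G"
proof -
  \<comment> \<open>(MEM) keeps the two formulas from both lying in \<open>D\<close>.\<close>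
  have "\<not> {|Box \<alpha>, Neg (Box \<alpha>)|} |\<subseteq>| D"
    using derivable_WKN[OF derivable_inference[OF inference.MEM[of G \<alpha>]], of G D] assms(1)
    unfolding consistent_def by auto
  then have "Box \<alpha> |\<in>| G \<or> Neg (Box \<alpha>) |\<in>| G"
    using assms unfolding consistent_def by blast
  then show ?thesis using consistent_not_Neg[OF assms(1)] by blast
qed

lemma consistent_And:
  assumes "consistent N G D" "And \<alpha> \<beta> |\<in>| formulas_upto N"
    and "\<alpha> |\<in>| formulas_upto N" "\<beta> |\<in>| formulas_upto N"
  shows "And \<alpha> \<beta> |\<in>| G \<longleftrightarrow> \<alpha> |\<in>| G \<and> \<beta> |\<in>| G"
proof
  have 1: "derivable ({|And \<alpha> \<beta>|} \<turnstile> {|\<alpha>|})"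
    by (rule derivable_inference1[OF inference.AndL1]) (simp add: derivable_AX)
  have 2: "derivable ({|And \<alpha> \<beta>|} \<turnstile> {|\<beta>|})"
    by (rule derivable_inference1[OF inference.AndL2]) (simp add: derivable_AX)
  assume "And \<alpha> \<beta> |\<in>| G"
  then show "\<alpha> |\<in>| G \<and> \<beta> |\<in>| G"
    using consistent_deduct[OF assms(1) 1 _ assms(3)] consistent_deduct[OF assms(1) 2 _ assms(4)]
    by simp
next
  have 3: "derivable ({|\<alpha>, \<beta>|} \<turnstile> {|And \<alpha> \<beta>|})"
    by (rule derivable_inference[OF inference.AndR]) (auto intro: derivable_AX)
  assume "\<alpha> |\<in>| G \<and> \<beta> |\<in>| G"
  then show "And \<alpha> \<beta> |\<in>| G"
    by (intro consistent_deduct[OF assms(1) 3 _ assms(2)]) simp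
qed

lemma coherent_state:
  assumes "consistent N G D"
  shows "coherent N (state N G)"
proof -
  note U = mem_formulas_upto[of _ N]
  \<comment> \<open>\<open>decode (neg_code a)\<close> is \<open>Neg (decode a)\<close>, so the
    first clause for \<open>neg_code\<close> is immediate; this equivalence is the second.\<close>
  have nn: "Neg (Neg (decode a)) |\<in>| G \<longleftrightarrow> decode a |\<in>| G" if "neg_code a \<le> N" for a
    using consistent_Neg_Neg[OF assms, of "decode a"] U(1)[of a] U(2)[OF that] that
      less_neg_code[of a] by simp
  have box: "Neg (Box (decode a)) |\<in>| G \<longleftrightarrow> Box (decode a) |\<notin>| G" if "box_code a \<le> N" for a
    using consistent_Neg_Box[OF assms, of "decode a"] U[OF that] by simp
  have "and": "And (decode a) (decode b) |\<in>| G \<longleftrightarrow> decode a |\<in>| G \<and> decode b |\<in>| G"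
    if "and_code a b \<le> N" for a b
    using consistent_And[OF assms, of "decode a" "decode b"] U(1)[OF that] U(1)[of a] U(1)[of b] that
      less_and_code[where a = a and b = b] by (simp flip: One_nat_def)
  have "\<not> (decode a |\<in>| G \<and> Neg (decode a) |\<in>| G)" for a
    using consistent_not_Neg[OF assms, of "decode a"] by blast
  then show ?thesis
    unfolding coherent_def set_decode_state mem_Collect_eq less_Suc_eq_le decode_code
    using nn box "and" by (simp flip: One_nat_def)
qed

text \<open>Compatible witnesses come from (\<not>r) through \<open>consistent_compatible\<close>,
  accessible ones from (K).\<close>

lemma saturated_state:
  assumes "consistent N G D"
  shows "saturated N (canonical N) (state N G)"
  unfolding saturated_def
proof (intro allI impI conjI)
  fix a assume a: "a < Suc N"
  then have U: "decode a |\<in>| formulas_upto N" "Neg (decode a) |\<in>| formulas_upto N"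
    using mem_formulas_upto[of a N] by simp_all
  {
    assume "\<not> a \<in> set_decode (fst (state N G))"
    then have "decode a |\<notin>| G" using a by simp
    then have "\<not> derivable (G \<turnstile> {|decode a|})" using consistent_deduct[OF assms] U by blast
    \<comment> \<open>If \<open>G\<close> derived the double negation, a cut would derive
      \<open>decode a\<close>; so \<open>consistent_compatible\<close> applies to
      \<open>Neg (decode a)\<close>.\<close>
    moreover have "derivable (finsert (Neg (Neg (decode a))) G \<turnstile> {|decode a|})"
      by (rule derivable_WKN[OF derivable_Neg_Neg(1)]) auto
    ultimately have "\<not> derivable (G \<turnstile> {|Neg (Neg (decode a)), decode a|})"
      using derivable_CUT by blast
    then have "\<not> derivable (G \<turnstile> {|Neg (Neg (decode a))|})"
      using derivable_WKN[of G "{|Neg (Neg (decode a))|}" G "{|Neg (Neg (decode a)), decode a|}"]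
      by auto
    then obtain G' D' where G': "consistent N G' D'" "compatible N (state N G) (state N G')"
      "Neg (decode a) |\<in>| G'"
      by (rule consistent_compatible[OF assms])
    then have "state N G' \<in> canonical N" unfolding canonical_def by blast
    with G' a show "\<exists>v \<in> canonical N. compatible N (state N G) v \<and> a \<in> set_decode (snd v)"
      by (intro bexI[of _ "state N G'"]) simp_all
  next
    assume "\<not> a \<in> set_decode (snd (state N G))"
    then have "\<not> derivable (G \<turnstile> {|Neg (decode a)|})"
      using a consistent_deduct[OF assms] U by auto
    then obtain G' D' where G': "consistent N G' D'" "compatible N (state N G) (state N G')"
      "decode a |\<in>| G'"
      by (rule consistent_compatible[OF assms])
    then have "state N G' \<in> canonical N" unfolding canonical_def by blast
    with G' a show "\<exists>v \<in> canonical N. compatible N (state N G) v \<and> a \<in> set_decode (fst v)"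
      by (intro bexI[of _ "state N G'"]) simp_all
  next
    assume box: "box_code a \<le> N" "\<not> box_code a \<in> set_decode (fst (state N G))"
    \<comment> \<open>What an accessible state must make true; (K) would turn a derivation of
      \<open>decode a\<close> from these into one of its box from \<open>G\<close>.\<close>
    define \<Gamma> where "\<Gamma> = ffilter (\<lambda>\<beta>. Box \<beta> |\<in>| G) (decoded_upto N)"
    have "\<not> derivable (\<Gamma> \<turnstile> {|decode a|})"
    proof
      assume "derivable (\<Gamma> \<turnstile> {|decode a|})"
      then have "derivable (Box |`| \<Gamma> \<turnstile> {|Box (decode a)|})"
        by (rule derivable_inference1[OF inference.K])
      then have "Box (decode a) |\<in>| G"
        by (rule consistent_deduct[OF assms])
          (use mem_formulas_upto(1)[OF box(1)] in \<open>auto simp: \<Gamma>_def\<close>)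
      then show False using box by simp
    qed
    then obtain G' D' where G': "\<Gamma> |\<subseteq>| G'" "{|decode a|} |\<subseteq>| D'" "consistent N G' D'"
      by (rule consistent_extend)
    then have "state N G' \<in> canonical N" unfolding canonical_def by blast
    moreover have "access N (state N G) (state N G')"
      unfolding access_def
    proof (intro allI impI)
      fix b assume b: "b < Suc N" "box_code b \<le> N" "box_code b \<in> set_decode (fst (state N G))"
      then have "decode b |\<in>| \<Gamma>" using decode_mem_decoded_upto unfolding \<Gamma>_def by simp
      then show "b \<in> set_decode (fst (state N G'))" using b(1) G'(1) by auto
    qed
    moreover have "\<not> a \<in> set_decode (fst (state N G'))"
      using G'(2) consistent_disjoint[OF G'(3)] by auto
    ultimately show "\<exists>v \<in> canonical N. access N (state N G) v \<and> \<not> a \<in> set_decode (fst v)"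
      by blast
  }
qed

lemma is_model_canonical: "is_model N (canonical N)"
  using coherent_state saturated_state unfolding is_model_def canonical_def by blast

section \<open>The decision procedure\<close>

text \<open>Components of states are bit vectors over the codes 0 to \<open>N\<close>, and
  \<open>S\<close> is one over codes of states.\<close>

definition coded :: "nat \<Rightarrow> nat \<Rightarrow> (nat \<times> nat) set" where
  "coded N S = {(s, t). s < 2 ^ Suc N \<and> t < 2 ^ Suc N \<and> prod_encode (s, t) \<in> set_decode S}"

text \<open>\<open>N\<close> is both the bound and the code of the formula refuted. The bound on
  \<open>S\<close> leaves room for every set of such states.\<close>

definition refutable :: "nat \<Rightarrow> bool" where
  "refutable N \<longleftrightarrow> (\<exists>S < 2 ^ prod_encode (2 ^ Suc N, 2 ^ Suc N).
    is_model N (coded N S) \<and> (\<exists>w \<in> coded N S. \<not> N \<in> set_decode (fst w)))"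

lemma set_encode_less:
  assumes "A \<subseteq> {..<n}"
  shows "set_encode A < 2 ^ n"
proof -
  have "set_encode A \<le> set_encode {..<n}"
    unfolding set_encode_def using assms by (intro sum_mono2) auto
  also have "\<dots> < 2 ^ n"
    unfolding set_encode_def by (induction n) (auto simp: lessThan_Suc)
  finally show ?thesis .
qed

lemma canonical_coded:
  obtains S where "S < 2 ^ prod_encode (2 ^ Suc N, 2 ^ Suc N)" "coded N S = canonical N"
proof
  let ?B = "2 ^ Suc N :: nat"
  let ?S = "set_encode (prod_encode ` canonical N)"
  have less: "s < ?B \<and> t < ?B" if "(s, t) \<in> canonical N" for s t
    using that unfolding canonical_def state_def by (auto intro!: set_encode_less simp del: power_Suc)
  have "prod_encode (s, t) < prod_encode (?B, ?B)" if "s < ?B" "t < ?B" for s t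
  proof -
    \<comment> \<open>Monotonicity of \<open>triangle\<close> puts the codes of all pairs in the
      square below that of its corner.\<close>
    have "triangle m \<le> triangle n" if "m \<le> n" for m n
      using that by (induction rule: dec_induct) simp_all
    then show ?thesis using that unfolding prod_encode_def by (simp add: add_le_less_mono)
  qed
  with less have sub: "prod_encode ` canonical N \<subseteq> {..<prod_encode (?B, ?B)}" by auto
  then show "?S < 2 ^ prod_encode (?B, ?B)" by (rule set_encode_less)
  have "finite (prod_encode ` canonical N)" using sub finite_subset by blast
  then have "set_decode ?S = prod_encode ` canonical N" by simp
  then show "coded N ?S = canonical N"
    using less unfolding coded_def by (auto simp: prod_encode_eq simp del: power_Suc)
qed

text \<open>Soundness and the truth lemma put the code of a derivable formula into every state of
  every model; an underivable one fails in the canonical model.\<close>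

lemma derivable_iff_not_refutable: "derivable ({||} \<turnstile> {|\<alpha>|}) \<longleftrightarrow> \<not> refutable (goedel \<alpha>)"
proof
  let ?N = "goedel \<alpha>"
  assume der: "derivable ({||} \<turnstile> {|\<alpha>|})"
  have "?N \<in> set_decode (fst w)" if "is_model ?N W" "w \<in> W" for w W
    using derivable_holds[OF that(1) der that(2)] sat_iff_mem[OF that, of \<alpha>] by simp
  then show "\<not> refutable ?N" unfolding refutable_def by blast
next
  let ?N = "goedel \<alpha>"
  assume nref: "\<not> refutable ?N"
  show "derivable ({||} \<turnstile> {|\<alpha>|})"
  proof (rule ccontr)
    assume "\<not> derivable ({||} \<turnstile> {|\<alpha>|})"
    then obtain G D where GD: "{|\<alpha>|} |\<subseteq>| D" "consistent ?N G D" using consistent_extend by metis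
    then have "state ?N G \<in> canonical ?N" "\<not> ?N \<in> set_decode (fst (state ?N G))"
      using consistent_disjoint[OF GD(2)] unfolding canonical_def by auto
    moreover obtain S where "S < 2 ^ prod_encode (2 ^ Suc ?N, 2 ^ Suc ?N)" "coded ?N S = canonical ?N"
      by (rule canonical_coded)
    ultimately show False using nref is_model_canonical[of ?N] unfolding refutable_def by metis
  qed
qed

text \<open>Turns quantifiers over states into the bounded numerical ones of
  \<open>decidable_rel_all\<close> and \<open>decidable_rel_ex\<close>.\<close>

lemma ball_coded: "(\<forall>w \<in> coded N S. P w) \<longleftrightarrow>
    (\<forall>s < 2 ^ Suc N. \<forall>t < 2 ^ Suc N. prod_encode (s, t) \<in> set_decode S \<longrightarrow> P (s, t))"
  and bex_coded: "(\<exists>w \<in> coded N S. P w) \<longleftrightarrow>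
    (\<exists>s < 2 ^ Suc N. \<exists>t < 2 ^ Suc N. prod_encode (s, t) \<in> set_decode S \<and> P (s, t))"
  unfolding coded_def by blast+

lemma decidable_refutable: "decidable_rel [\<lambda>N. N] refutable"
  unfolding refutable_def is_model_def coherent_def saturated_def compatible_def access_def
    ball_coded bex_coded fst_conv snd_conv
  by (rule comp | (rule computable_var, simp; fail))+

theorem theorem1: "decidable (\<lambda>\<alpha>. derivable ({||} \<turnstile> {|\<alpha>|}))"
proof -
  \<comment> \<open>The input \<open>goedel \<alpha>\<close> serves directly as \<open>N\<close>, so
    the algorithm never decodes it.\<close>
  from decidable_rel_not[OF decidable_refutable] obtain f
    where "\<And>N. eval f [N] (of_bool (\<not> refutable N))"
    unfolding decidable_rel_def computable_def by auto
  then show ?thesis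
    unfolding decidable_def derivable_iff_not_refutable of_bool_def by blast
qed

end
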